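(* Let $n \geq 1$ be an integer and $m = 2^n$. Then the edge set of the hypercube $Q_m$ contains $m$ pairwise edge-disjoint perfect matchings $M_1, \dots, M_m$ such that for every $i \in \{1,\dots,m\}$, the union $M_i \cup M_{i+1}$ (indices taken modulo $m$) is the edge set of a Hamiltonian cycle of $Q_m$.
   Context: The $m$-dimensional hypercube $Q_m$ has vertex set $\{0,1\}^m$, two vertices being adjacent iff they differ in exactly one coordinate. A perfect matching is a set of edges such that every vertex is incident to exactly one of them. *)

theory Defs
  imports Main
begin

(* Undirected simple graphs are given by a vertex set V and a set E of two-element subsets of V. *)

definition hypercube_verts :: "nat \<Rightarrow> bool list set" where
  "hypercube_verts m = {x. length x = m}"

definition hypercube_edges :: "nat \<Rightarrow> bool list set set" where
  "hypercube_edges m =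
     {{x, y} | x y. x \<in> hypercube_verts m \<and> y \<in> hypercube_verts m
        \<and> card {k. k < m \<and> x ! k \<noteq> y ! k} = 1}"

definition perfect_matching :: "'a set \<Rightarrow> 'a set set \<Rightarrow> 'a set set \<Rightarrow> bool" where
  "perfect_matching V E M \<longleftrightarrow> M \<subseteq> E \<and> (\<forall>v\<in>V. \<exists>!e. e \<in> M \<and> v \<in> e)"

definition cyclic_edges :: "'a list \<Rightarrow> 'a set set" where
  "cyclic_edges vs = {{vs ! j, vs ! (Suc j mod length vs)} | j. j < length vs}"

(* The bound 3 rules out the degenerate closed walks on one or two vertices. *)
definition hamiltonian_cycle_edges :: "'a set \<Rightarrow> 'a set set \<Rightarrow> 'a set set \<Rightarrow> bool" where
  "hamiltonian_cycle_edges V E C \<longleftrightarrow>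
     (\<exists>vs. distinct vs \<and> set vs = V \<and> 3 \<le> length vs \<and> cyclic_edges vs \<subseteq> E \<and> C = cyclic_edges vs)"

end

(*
Induction on n, writing Q_2m as the product of Q_m with itself. Let p_0, p_1, ... be the matchings of
Q_m, indexed modulo m. The matchings of Q_2m are H_0, V_0, H_1, V_1, ...: in each row H_s uses p_s
or p_(s+1) according to the parity of the row, and in each column V_s does so according to the parity
of the column, except that H_s uses p_(s+1) also in one single even row y0. Put N = 2^m. Without the
exceptional row, the union of two consecutive matchings is a union of N/2 cycles of length 2N, each
of which has exactly one edge in row y0. Replacing these edges, which form one matching of row y0,
by the other matching joins the N/2 remaining paths in the order of a Hamiltonian cycle of Q_m.
*)

theory Submission
  imports Defs
begin

section \<open>Pairs of perfect matchings as involutions\<close>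

text \<open>A perfect matching of a bipartite graph, with edges \<open>{v, p v}\<close>. The change
  of colour excludes fixed points and makes a product of two matchings preserve the colour
  classes.\<close>

definition flips :: "'a set \<Rightarrow> ('a \<Rightarrow> bool) \<Rightarrow> ('a \<Rightarrow> 'a) \<Rightarrow> bool" where
  "flips V col p \<longleftrightarrow> (\<forall>v\<in>V. p v \<in> V \<and> p (p v) = v \<and> col (p v) \<noteq> col v)"

text \<open>Connectedness of the union of two matchings that are given as involutions.\<close>

definition linked :: "'a set \<Rightarrow> ('a \<Rightarrow> 'a) \<Rightarrow> ('a \<Rightarrow> 'a) \<Rightarrow> bool" where
  "linked V p q \<longleftrightarrow> (\<forall>S\<subseteq>V. S \<noteq> {} \<longrightarrow> p ` S \<subseteq> S \<longrightarrow> q ` S \<subseteq> S \<longrightarrow> S = V)"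

lemma flipsD:
  assumes "flips V col p" "v \<in> V"
  shows "p v \<in> V" "p (p v) = v" "col (p v) \<longleftrightarrow> \<not> col v"
  using assms by (auto simp: flips_def)

lemma linked_sym: "linked V p q \<longleftrightarrow> linked V q p"
  by (auto simp: linked_def)

text \<open>An induction rule along alternating paths: the vertices of \<open>V\<close> satisfying
  \<open>P\<close> form a nonempty set closed under both involutions.\<close>

lemma linked_all:
  assumes "linked V p q" "flips V col p" "flips V col q" "u \<in> V" "P u" "v \<in> V"
    and "\<And>v. v \<in> V \<Longrightarrow> P v \<Longrightarrow> P (p v)" "\<And>v. v \<in> V \<Longrightarrow> P v \<Longrightarrow> P (q v)"
  shows "P v"
proof -
  have "{v \<in> V. P v} = V"
    by (rule assms(1)[unfolded linked_def, rule_format])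
      (use assms in \<open>auto simp: flips_def\<close>)
  then show ?thesis using \<open>v \<in> V\<close> by blast
qed

lemma linked_orbit:
  assumes fin: "finite V" and p: "flips V col p" and q: "flips V col q"
    and pq: "linked V p q" and v: "v \<in> V"
  defines "r \<equiv> q \<circ> p" and "L \<equiv> card V div 2"
  shows "0 < L" "(r ^^ L) v = v" "inj_on (\<lambda>t. (r ^^ t) v) {..<L}"
    "V = (\<lambda>t. (r ^^ t) v) ` {..<L} \<union> p ` (\<lambda>t. (r ^^ t) v) ` {..<L}"
    "\<And>t. (r ^^ t) v \<in> V" "\<And>t. col ((r ^^ t) v) = col v"
proof -
  have rV: "r u \<in> V" "col (r u) = col u" if "u \<in> V" for u
    using that p q by (auto simp: r_def dest: flipsD)
  have tV: "(r ^^ t) u \<in> V \<and> col ((r ^^ t) u) = col u" if "u \<in> V" for t u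
    by (induction t) (use that rV in auto)
  have "inj_on r V"
    by (rule inj_on_inverseI[of _ "p \<circ> q"]) (use p q in \<open>auto simp: r_def flips_def\<close>)
  have "bij_betw r V V"
    using \<open>inj_on r V\<close> rV fin by (simp add: bij_betw_def endo_inj_surj image_subsetI)
  then have injr: "inj_on (r ^^ t) V" for t
    using bij_betw_funpow bij_betw_imp_inj_on by blast
  \<comment> \<open>Powers of \<open>r\<close> are injective on \<open>V\<close>, so any repetition
    in the orbit can be pulled back to its starting point.\<close>
  have cancel: "(r ^^ (j - i)) v = v" if "i < j" "(r ^^ i) v = (r ^^ j) v" for i j
  proof -
    have "(r ^^ i) ((r ^^ (j - i)) v) = (r ^^ i) v"
      using that by (simp flip: comp_apply[of "r ^^ i"] funpow_add)
    then show ?thesis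
      using injr[of i] tV[OF v, of "j - i"] v by (auto dest: inj_onD)
  qed
  have "\<not> inj_on (\<lambda>t. (r ^^ t) v) UNIV"
    using finite_imageD[of "\<lambda>t. (r ^^ t) v" UNIV] finite_subset[OF _ fin] tV[OF v]
    by (metis (no_types, lifting) image_subsetI infinite_UNIV_nat)
  then obtain i j where "i < j" "(r ^^ i) v = (r ^^ j) v"
    unfolding inj_on_def by (metis linorder_neqE_nat)
  then have ex: "\<exists>t>0. (r ^^ t) v = v"
    using cancel zero_less_diff by blast
  define K where "K = (LEAST t. 0 < t \<and> (r ^^ t) v = v)"
  have K: "0 < K" "(r ^^ K) v = v"
    using LeastI_ex[OF ex] by (auto simp: K_def)
  have least: "K \<le> t" if "0 < t" "(r ^^ t) v = v" for t
    unfolding K_def using that by (intro Least_le) auto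
  have inj: "inj_on (\<lambda>t. (r ^^ t) v) {..<K}"
  proof (rule linorder_inj_onI')
    fix i j assume "i \<in> {..<K}" "j \<in> {..<K}" "i < j"
    then show "(r ^^ i) v \<noteq> (r ^^ j) v"
      using cancel[of i j] least[of "j - i"] by auto
  qed
  define W where "W = (\<lambda>t. (r ^^ t) v) ` {..<K}"
  have WV: "W \<subseteq> V" and Wcol: "\<And>w. w \<in> W \<Longrightarrow> col w = col v" and vW: "v \<in> W"
    using tV[OF v] K(1) by (auto simp: W_def image_iff intro: bexI[of _ 0])
  have rW: "r w \<in> W" if w: "w \<in> W" for w
  proof -
    obtain t where t: "t < K" "w = (r ^^ t) v" using w by (auto simp: W_def)
    have "r w = (r ^^ Suc t) v" using t by simp
    then show ?thesis
      using t(1) K(2) vW by (cases "Suc t = K") (auto simp: W_def simp del: funpow.simps)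
  qed
  \<comment> \<open>If \<open>w = r w'\<close> with \<open>w'\<close> in the orbit, then
    \<open>q w = p w'\<close>. The predecessor of \<open>v\<close> itself is the last point, at time
    \<open>K - 1\<close>.\<close>
  have qW: "q w \<in> p ` W" if w: "w \<in> W" for w
  proof -
    obtain t where t: "t < K" "w = (r ^^ t) v" using w by (auto simp: W_def)
    obtain s where s: "s < K" "w = (r ^^ Suc s) v"
    proof (cases t)
      case 0
      then show ?thesis using that[of "K - 1"] K t by (simp del: funpow.simps)
    next
      case (Suc s)
      then show ?thesis using that[of s] t by simp
    qed
    have "q w = p ((r ^^ s) v)"
      using s(2) tV[OF v, of s] p q by (auto simp: r_def dest: flipsD)
    then show ?thesis using s(1) by (auto simp: W_def)
  qed
  have WW: "W \<union> p ` W = V"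
  proof (rule pq[unfolded linked_def, rule_format])
    show "W \<union> p ` W \<subseteq> V" using WV p by (auto dest: flipsD)
    show "W \<union> p ` W \<noteq> {}" using vW by auto
    show "p ` (W \<union> p ` W) \<subseteq> W \<union> p ` W"
      using WV p by (auto simp: flips_def subset_iff)
    show "q ` (W \<union> p ` W) \<subseteq> W \<union> p ` W"
      using qW rW by (auto simp: r_def)
  qed
  have "W \<inter> p ` W = {}"
    using Wcol WV p by (fastforce dest: flipsD)
  moreover have "inj_on p W"
    by (rule inj_on_inverseI[of _ p]) (use p WV in \<open>auto simp: flips_def\<close>)
  moreover have "finite W" by (simp add: W_def)
  ultimately have "card V = 2 * card W"
    by (simp add: card_Un_disjoint card_image flip: WW)
  moreover have "card W = K" using inj by (simp add: W_def card_image)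
  ultimately have "K = L" by (simp add: L_def)
  then show "0 < L" "(r ^^ L) v = v" "inj_on (\<lambda>t. (r ^^ t) v) {..<L}"
    "V = (\<lambda>t. (r ^^ t) v) ` {..<L} \<union> p ` (\<lambda>t. (r ^^ t) v) ` {..<L}"
    "\<And>t. (r ^^ t) v \<in> V" "\<And>t. col ((r ^^ t) v) = col v"
    using K inj WW tV[OF v] by (auto simp: W_def)
qed

text \<open>Interleaving the orbit with its image under \<open>p\<close> gives the closed walk
  \<open>u 0, p (u 0), u 1, p (u 1), ...\<close>, whose edges belong alternately to \<open>p\<close>
  and \<open>q\<close>. Two vertices with \<open>p = q\<close> are allowed here, so the length bound
  is left to the application.\<close>

lemma linked_cycle:
  assumes fin: "finite V" and p: "flips V col p" and q: "flips V col q"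
    and pq: "linked V p q" and ne: "V \<noteq> {}"
  shows "\<exists>vs. distinct vs \<and> set vs = V \<and>
    cyclic_edges vs = (\<lambda>v. {v, p v}) ` V \<union> (\<lambda>v. {v, q v}) ` V"
proof -
  obtain v where v: "v \<in> V" using ne by blast
  define r L where "r = q \<circ> p" and "L = card V div 2"
  note orb = linked_orbit[OF fin p q pq v, folded r_def L_def]
  define u where "u = (\<lambda>t. (r ^^ t) v)"
  have u: "u t \<in> V" "col (u t) = col v" "u (Suc t) = q (p (u t))" "u L = u 0" for t
    using orb by (auto simp: u_def r_def)
  have V: "V = u ` {..<L} \<union> p ` u ` {..<L}" and inj: "inj_on u {..<L}"
    using orb by (auto simp: u_def)
  define w where "w = (\<lambda>j. if even j then u (j div 2) else p (u (j div 2)))"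
  define vs where "vs = map w [0..<2 * L]"
  have w2: "w (2 * t) = u t" "w (Suc (2 * t)) = p (u t)" for t
    by (auto simp: w_def)
  have halves: "\<exists>t<L. j = 2 * t \<or> j = Suc (2 * t)" if j: "j < 2 * L" for j
  proof -
    have "j div 2 < L" using j by simp
    moreover have "j = 2 * (j div 2) \<or> j = Suc (2 * (j div 2))" by presburger
    ultimately show ?thesis by blast
  qed
  have set_vs: "set vs = V"
  proof -
    have "set vs = w ` {..<2 * L}" by (simp add: vs_def atLeast0LessThan)
    also have "\<dots> = V"
    proof
      show "w ` {..<2 * L} \<subseteq> V"
        using u(1) p by (auto simp: w_def dest: flipsD)
      show "V \<subseteq> w ` {..<2 * L}"
      proof
        fix x assume "x \<in> V"
        then obtain t where "t < L" "x = w (2 * t) \<or> x = w (Suc (2 * t))"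
          using V w2 by auto
        then show "x \<in> w ` {..<2 * L}"
          by (auto intro!: imageI)
      qed
    qed
    finally show ?thesis .
  qed
  have "inj_on w {..<2 * L}"
  proof (rule inj_onI)
    fix i j assume ij: "i \<in> {..<2 * L}" "j \<in> {..<2 * L}" "w i = w j"
    obtain s where s: "s < L" "i = 2 * s \<or> i = Suc (2 * s)" using halves ij by auto
    obtain t where t: "t < L" "j = 2 * t \<or> j = Suc (2 * t)" using halves ij by auto
    have c: "col (p (u k)) \<longleftrightarrow> \<not> col v" "p (p (u k)) = u k" for k
      using p u(1,2) by (auto dest: flipsD)
    \<comment> \<open>The colour of a vertex on the walk reveals the parity of its position.\<close>
    have "even i \<longleftrightarrow> even j"
      using arg_cong[OF ij(3), of col] c(1) u(2) by (auto simp: w_def split: if_splits)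
    then have st: "(i = 2 * s \<and> j = 2 * t) \<or> (i = Suc (2 * s) \<and> j = Suc (2 * t))"
      using s(2) t(2) by auto
    from st have "u s = u t"
    proof
      assume "i = 2 * s \<and> j = 2 * t"
      then show ?thesis using ij(3) w2 by simp
    next
      assume "i = Suc (2 * s) \<and> j = Suc (2 * t)"
      then have "p (u s) = p (u t)" using ij(3) w2 by simp
      then show ?thesis using c(2) by metis
    qed
    then have "s = t" using inj s(1) t(1) by (auto dest: inj_onD)
    then show "i = j" using st by auto
  qed
  then have dist: "distinct vs"
    by (simp add: vs_def distinct_map atLeast0LessThan)
  have nxt: "vs ! (Suc j mod length vs) = w (Suc j)" if "j < 2 * L" for j
  proof (cases "Suc j = 2 * L")
    case True
    then have "w (Suc j) = w 0" using w2(1)[of L] w2(1)[of 0] u(4) by simp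
    then show ?thesis using True that by (simp add: vs_def)
  next
    case False
    then show ?thesis using that by (simp add: vs_def)
  qed
  have ce: "cyclic_edges vs = {{w j, w (Suc j)} |j. j < 2 * L}"
  proof -
    have "{vs ! j, vs ! (Suc j mod length vs)} = {w j, w (Suc j)}" if "j < 2 * L" for j
      using nxt[OF that] that by (simp add: vs_def)
    moreover have "length vs = 2 * L" by (simp add: vs_def)
    ultimately show ?thesis unfolding cyclic_edges_def by (metis (no_types, lifting))
  qed
  have edge: "{u t, p (u t)} \<in> cyclic_edges vs" "{p (u t), u (Suc t)} \<in> cyclic_edges vs"
    if "t < L" for t
  proof -
    have "{u t, p (u t)} = {w (2 * t), w (Suc (2 * t))}" by (simp add: w2)
    moreover have "{p (u t), u (Suc t)} = {w (Suc (2 * t)), w (Suc (Suc (2 * t)))}"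
      using w2(1)[of "Suc t"] by (simp add: w2)
    moreover have "2 * t < 2 * L" "Suc (2 * t) < 2 * L" using that by auto
    ultimately show "{u t, p (u t)} \<in> cyclic_edges vs"
      "{p (u t), u (Suc t)} \<in> cyclic_edges vs" unfolding ce by blast+
  qed
  have "cyclic_edges vs = (\<lambda>v. {v, p v}) ` V \<union> (\<lambda>v. {v, q v}) ` V" (is "_ = ?R")
  proof
    show "cyclic_edges vs \<subseteq> ?R"
    proof
      fix e assume "e \<in> cyclic_edges vs"
      then obtain j where "j < 2 * L" "e = {w j, w (Suc j)}" unfolding ce by auto
      then obtain t where t: "t < L" "e = {u t, p (u t)} \<or> e = {p (u t), u (Suc t)}"
        using halves[of j] w2 w2(1)[of "Suc t" for t] by fastforce
      have "p (u t) \<in> V" using u(1) p by (auto dest: flipsD)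
      then show "e \<in> ?R" using t u(1,3) by auto
    qed
    have "{x, p x} \<in> cyclic_edges vs \<and> {x, q x} \<in> cyclic_edges vs" if x: "x \<in> V" for x
    proof -
      obtain t where t: "t < L" "x = u t \<or> x = p (u t)" using x V by auto
      have pp: "p (p (u s)) = u s" "q (q (p (u s))) = p (u s)" for s
        using u(1)[of s] p q by (auto dest: flipsD)
      obtain s where s: "s < L" "u t = u (Suc s)"
      proof (cases t)
        case 0
        then show ?thesis using that[of "L - 1"] t(1) u(4) by auto
      next
        case (Suc s)
        then show ?thesis using that[of s] t(1) by auto
      qed
      then have qu: "q (u t) = p (u s)" using u(3) pp by simp
      show ?thesis using t(2)
      proof
        assume "x = u t"
        then show ?thesis
          using edge(1)[OF t(1)] edge(2)[OF s(1)] s(2) qu by (simp add: insert_commute)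
      next
        assume "x = p (u t)"
        then show ?thesis
          using edge[OF t(1)] u(3)[of t] pp(1)[of t] by (simp add: insert_commute)
      qed
    qed
    then show "?R \<subseteq> cyclic_edges vs" by auto
  qed
  then show ?thesis using dist set_vs by blast
qed

section \<open>Connectedness on the product of two copies\<close>

text \<open>Applied to membership \<open>Q\<close> in a set of vertices that is closed under both matchings.\<close>

lemma torus_connected:
  assumes fin: "finite V" and x0: "x0 \<in> V" "y0 \<in> V" "y1 \<in> V" "Q x0 y1"
    and a: "flips V col a" and b: "flips V col b" and ab: "linked V a b"
    and c: "flips V col c" and d: "flips V col d" and cd: "linked V c d"
    and H: "\<And>x y. x \<in> V \<Longrightarrow> y \<in> V \<Longrightarrow>
      Q (if y \<noteq> y0 \<and> col y = col y0 then a x else b x) y \<longleftrightarrow> Q x y"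
    and W: "\<And>x y. x \<in> V \<Longrightarrow> y \<in> V \<Longrightarrow> Q x (if col x then c y else d y) \<longleftrightarrow> Q x y"
    and xy: "x \<in> V" "y \<in> V"
  shows "Q x y"
proof -
  define L where "L = card V div 2"
  \<comment> \<open>Leave row \<open>y0\<close> by a vertical edge. Each four steps apply \<open>a \<circ> b\<close> to \<open>x\<close> and \<open>g \<circ> f\<close> to \<open>y0\<close>;
    both have period \<open>L\<close>, so the first return to row \<open>y0\<close> is one step short of \<open>(a \<circ> b)\<^sup>L x = x\<close>, at \<open>a x\<close>.\<close>
  have row_aux: "Q (a x) y0 \<longleftrightarrow> Q x y0"
    if x: "x \<in> V" and f: "flips V col f" and g: "flips V col g" and fg: "linked V f g"
      and W: "\<And>x' y. x' \<in> V \<Longrightarrow> y \<in> V \<Longrightarrow> Q x' (if col x' = col x then f y else g y) \<longleftrightarrow> Q x' y"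
    for x f g
  proof -
    define u where "u = (\<lambda>t. ((a \<circ> b) ^^ t) x)"
    define w where "w = (\<lambda>t. ((g \<circ> f) ^^ t) y0)"
    note ou = linked_orbit[OF fin b a _ x, folded L_def u_def]
    note ow = linked_orbit[OF fin f g fg x0(2), folded L_def w_def]
    have ba: "linked V b a" using ab linked_sym by blast
    have uV: "u t \<in> V" "col (u t) = col x" "u (Suc t) = a (b (u t))" for t
      using ou(5,6)[OF ba] by (auto simp: u_def)
    have wV: "w t \<in> V" "col (w t) = col y0" "w (Suc t) = g (f (w t))" for t
      using ow(5,6) by (auto simp: w_def)
    \<comment> \<open>Three of the four steps: \<open>f\<close> in the column \<open>u t\<close>,
      \<open>b\<close> in a row whose colour differs from that of \<open>y0\<close>, and
      \<open>g\<close> in a column of the other colour. The fourth step, by \<open>a\<close>, is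
      available only in a row other than \<open>y0\<close>.\<close>
    have half: "Q (b (u t)) (w (Suc t)) \<longleftrightarrow> Q (u t) (w t)" for t
    proof -
      have bu: "b (u t) \<in> V" "col (b (u t)) \<longleftrightarrow> \<not> col x"
        using uV(1,2)[of t] b by (auto dest: flipsD)
      have fw: "f (w t) \<in> V" "col (f (w t)) \<longleftrightarrow> \<not> col y0"
        using wV(1,2)[of t] f by (auto dest: flipsD)
      have "Q (b (u t)) (w (Suc t)) \<longleftrightarrow> Q (b (u t)) (f (w t))"
        using W[OF bu(1) fw(1)] bu(2) wV(3) by (auto split: if_splits)
      also have "\<dots> \<longleftrightarrow> Q (u t) (f (w t))"
        using H[OF uV(1)[of t] fw(1)] fw(2) by (auto split: if_splits)
      also have "\<dots> \<longleftrightarrow> Q (u t) (w t)"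
        using W[OF uV(1)[of t] wV(1)[of t]] uV(2) by simp
      finally show ?thesis .
    qed
    \<comment> \<open>Injectivity of the orbit excludes an early return to the exceptional
      row.\<close>
    have ne: "w t \<noteq> y0" if "0 < t" "t < L" for t
      using inj_onD[OF ow(3), of t 0] that by (auto simp: w_def)
    have steps: "t < L \<Longrightarrow> Q (u t) (w t) \<longleftrightarrow> Q x y0" for t
    proof (induction t)
      case 0
      then show ?case by (simp add: u_def w_def)
    next
      case (Suc t)
      have "b (u t) \<in> V" using uV(1) b by (auto dest: flipsD)
      then have "Q (u (Suc t)) (w (Suc t)) \<longleftrightarrow> Q (b (u t)) (w (Suc t))"
        using H[of "b (u t)" "w (Suc t)"] wV(1,2) ne[of "Suc t"] Suc.prems uV(3)
        by (simp del: wV(3))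
      then show ?case using half Suc by simp
    qed
    obtain k where k: "L = Suc k" using ow(1) gr0_implies_Suc by blast
    have "Q (b (u k)) y0 \<longleftrightarrow> Q x y0"
      using half[of k] steps[of k] ow(2) k by (simp add: w_def)
    moreover have "b (u k) = a x"
    proof -
      have "x = a (b (u k))" using ou(2)[OF ba] k uV(3) by (metis u_def)
      moreover have "b (u k) \<in> V" using uV(1) b by (auto dest: flipsD)
      ultimately show ?thesis using a by (metis flipsD(2))
    qed
    ultimately show ?thesis by simp
  qed
  \<comment> \<open>In columns of the other colour \<open>c\<close> and \<open>d\<close> exchange
    roles.\<close>
  have row_a: "Q (a x) y0 \<longleftrightarrow> Q x y0" if x: "x \<in> V" for x
  proof (cases "col x")
    case True
    then show ?thesis using row_aux[OF x c d cd] W by simp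
  next
    case False
    have "Q x' (if col x' = col x then d y else c y) \<longleftrightarrow> Q x' y" if "x' \<in> V" "y \<in> V" for x' y
      using W[OF that] False by (auto split: if_splits)
    then show ?thesis using row_aux[OF x d c] cd linked_sym by blast
  qed
  have row_b: "Q (b x) y0 \<longleftrightarrow> Q x y0" if "x \<in> V" for x
    using H[OF that x0(2)] by simp
  \<comment> \<open>Row \<open>y0\<close> contains only edges of \<open>b\<close>, but the detours
    replace those of \<open>a\<close>, so \<open>linked V a b\<close> makes \<open>Q\<close>
    constant on this row.\<close>
  have row: "Q x y0 \<longleftrightarrow> Q x' y0" if "x \<in> V" "x' \<in> V" for x x'
    by (rule linked_all[OF ab a b that(2), of "\<lambda>x. Q x y0 \<longleftrightarrow> Q x' y0"])
      (use row_a row_b that in auto)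
  have horiz: "\<exists>x'\<in>V. (col x' \<longleftrightarrow> \<not> col x) \<and> (Q x' y \<longleftrightarrow> Q x y)" if "x \<in> V" "y \<in> V" for x y
    by (rule bexI[of _ "if y \<noteq> y0 \<and> col y = col y0 then a x else b x"])
      (use H[OF that] flipsD[OF a that(1)] flipsD[OF b that(1)] in \<open>auto split: if_splits\<close>)
  \<comment> \<open>The vertical matching is \<open>f\<close> in columns of colour \<open>k\<close>.
    In any other column, a horizontal step within row \<open>f y\<close> first reaches a column of
    colour \<open>k\<close>.\<close>
  have column: "Q x (f y) \<longleftrightarrow> Q x0 y0"
    if f: "flips V col f" and x: "x \<in> V" and y: "y \<in> V" and IH: "\<forall>x\<in>V. Q x y \<longleftrightarrow> Q x0 y0"
      and W: "\<And>x. x \<in> V \<Longrightarrow> col x \<longleftrightarrow> k \<Longrightarrow> Q x (f y) \<longleftrightarrow> Q x y"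
    for f x y k
  proof (cases "col x \<longleftrightarrow> k")
    case True
    then show ?thesis using W x IH by blast
  next
    case False
    then show ?thesis using W x IH horiz[OF x] flipsD(1)[OF f y] by metis
  qed
  have reach: "\<forall>x\<in>V. Q x y \<longleftrightarrow> Q x0 y0" if y: "y \<in> V" for y
  proof (rule linked_all[OF cd c d x0(2), of "\<lambda>y. \<forall>x\<in>V. Q x y \<longleftrightarrow> Q x0 y0"])
    show "\<forall>x\<in>V. Q x y0 \<longleftrightarrow> Q x0 y0" using row x0 by blast
    show "\<forall>x\<in>V. Q x (c y) \<longleftrightarrow> Q x0 y0" if "y \<in> V" "\<forall>x\<in>V. Q x y \<longleftrightarrow> Q x0 y0" for y
      using column[OF c _ that, of _ True] W[OF _ that(1)] by (metis (full_types))
    show "\<forall>x\<in>V. Q x (d y) \<longleftrightarrow> Q x0 y0" if "y \<in> V" "\<forall>x\<in>V. Q x y \<longleftrightarrow> Q x0 y0" for y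
      using column[OF d _ that, of _ False] W[OF _ that(1)] by (metis (full_types))
  qed (rule y)
  show ?thesis using reach xy x0 by blast
qed


section \<open>Matchings of the hypercube\<close>

primrec parity :: "bool list \<Rightarrow> bool" where
  "parity [] = False"
| "parity (b # bs) = (b \<noteq> parity bs)"

lemma parity_append: "parity (xs @ ys) \<longleftrightarrow> parity xs \<noteq> parity ys"
  by (induction xs) auto

lemma parity_update: "k < length xs \<Longrightarrow> parity (xs[k := \<not> xs ! k]) \<longleftrightarrow> \<not> parity xs"
  by (induction xs arbitrary: k) (auto split: nat.split)

lemma parity_replicate_False: "\<not> parity (replicate n False)"
  by (induction n) auto

text \<open>Adjacency is stated as a list update because this form shows the change of parity and
  carries over to either half of \<open>x @ y\<close>. Nothing is required of \<open>p\<close> on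
  lists of other lengths.\<close>

definition cube_matching :: "nat \<Rightarrow> (bool list \<Rightarrow> bool list) \<Rightarrow> bool" where
  "cube_matching m p \<longleftrightarrow>
     (\<forall>v. length v = m \<longrightarrow> p (p v) = v \<and> (\<exists>k<m. p v = v[k := \<not> v ! k]))"

lemma cube_matching_length: "cube_matching m p \<Longrightarrow> length v = m \<Longrightarrow> length (p v) = m"
  unfolding cube_matching_def by (metis length_list_update)

lemma cube_matching_flips:
  assumes "cube_matching m p"
  shows "flips (hypercube_verts m) parity p"
  unfolding flips_def hypercube_verts_def
  using assms cube_matching_length[OF assms] parity_update
  by (auto simp: cube_matching_def)

text \<open>The sequence \<open>p\<close> is indexed by all naturals with period \<open>m\<close>, which avoids reductions modulo \<open>m\<close>.\<close>

definition matching_cycle :: "nat \<Rightarrow> (nat \<Rightarrow> bool list \<Rightarrow> bool list) \<Rightarrow> bool" where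
  "matching_cycle m p \<longleftrightarrow>
     (\<forall>i. cube_matching m (p i)) \<and> (\<forall>i. p (i + m) = p i) \<and>
     (\<forall>i j v. i < j \<longrightarrow> j < i + m \<longrightarrow> length v = m \<longrightarrow> p i v \<noteq> p j v) \<and>
     (\<forall>i. linked (hypercube_verts m) (p i) (p (Suc i)))"

text \<open>The single edge of the one-dimensional cube is linked with itself but is no Hamiltonian
  cycle; the induction can start here because it carries \<open>linked\<close> instead of
  cycles.\<close>

lemma matching_cycle_1: "matching_cycle 1 (\<lambda>i v. [\<not> hd v])"
proof -
  have "linked (hypercube_verts 1) (\<lambda>v. [\<not> hd v]) (\<lambda>v. [\<not> hd v])"
    unfolding linked_def
  proof (intro allI impI)
    fix S assume S: "S \<subseteq> hypercube_verts 1" "S \<noteq> {}" "(\<lambda>v. [\<not> hd v]) ` S \<subseteq> S"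
    obtain b where b: "[b] \<in> S"
      using S(1,2) by (auto simp: hypercube_verts_def length_Suc_conv)
    then have "[\<not> b] \<in> S" using S(3) by force
    then have "[c] \<in> S" for c using b by (cases "c = b") auto
    then show "S = hypercube_verts 1"
      using S(1) by (auto simp: hypercube_verts_def length_Suc_conv)
  qed
  then show ?thesis
    by (auto simp: matching_cycle_def cube_matching_def length_Suc_conv)
qed

section \<open>Doubling the dimension\<close>

text \<open>The row \<open>replicate m False\<close> is even, but is treated like the odd rows.\<close>

definition horizontal :: "nat \<Rightarrow> (nat \<Rightarrow> bool list \<Rightarrow> bool list) \<Rightarrow> nat \<Rightarrow> bool list \<Rightarrow> bool list" where
  "horizontal m p s z =
     (if drop m z \<noteq> replicate m False \<and> \<not> parity (drop m z) then p s (take m z)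
      else p (Suc s) (take m z)) @ drop m z"

definition vertical :: "nat \<Rightarrow> (nat \<Rightarrow> bool list \<Rightarrow> bool list) \<Rightarrow> nat \<Rightarrow> bool list \<Rightarrow> bool list" where
  "vertical m p s z =
     take m z @ (if parity (take m z) then p s (drop m z) else p (Suc s) (drop m z))"

definition doubled :: "nat \<Rightarrow> (nat \<Rightarrow> bool list \<Rightarrow> bool list) \<Rightarrow> nat \<Rightarrow> bool list \<Rightarrow> bool list" where
  "doubled m p i = (if even i then horizontal m p (i div 2) else vertical m p (i div 2))"

lemma horizontal_append:
  "length x = m \<Longrightarrow> horizontal m p s (x @ y) =
     (if y \<noteq> replicate m False \<and> \<not> parity y then p s x else p (Suc s) x) @ y"
  by (simp add: horizontal_def)

lemma vertical_append:
  "length x = m \<Longrightarrow> vertical m p s (x @ y) = x @ (if parity x then p s y else p (Suc s) y)"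
  by (simp add: vertical_def)

lemma append_split:
  assumes "length z = 2 * m"
  obtains x y where "z = x @ y" "length x = m" "length y = m"
  by (rule that[of "take m z" "drop m z"]) (use assms in auto)

text \<open>The row \<open>y\<close> is left unchanged, so the same matching \<open>q\<close> of the
  first factor is chosen in both applications.\<close>

lemma cube_matching_horizontal:
  assumes "\<And>i. cube_matching m (p i)"
  shows "cube_matching (2 * m) (horizontal m p s)"
  unfolding cube_matching_def
proof (intro allI impI)
  fix z :: "bool list" assume "length z = 2 * m"
  then obtain x y where z: "z = x @ y" "length x = m" "length y = m" by (rule append_split)
  define q where "q = (if y \<noteq> replicate m False \<and> \<not> parity y then p s else p (Suc s))"
  have q: "horizontal m p s (x' @ y) = q x' @ y" if "length x' = m" for x'
    using horizontal_append[OF that] by (simp add: q_def)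
  have cq: "cube_matching m q" using assms by (simp add: q_def)
  then obtain k where "k < m" "q x = x[k := \<not> x ! k]" and qq: "q (q x) = x"
    using z(2) unfolding cube_matching_def by blast
  then have "k < 2 * m" "horizontal m p s z = z[k := \<not> z ! k]"
    using q z by (simp_all add: list_update_append1 nth_append)
  then show "horizontal m p s (horizontal m p s z) = z \<and>
      (\<exists>k<2 * m. horizontal m p s z = z[k := \<not> z ! k])"
    using q z(1,2) qq cube_matching_length[OF cq] by metis
qed

lemma cube_matching_vertical:
  assumes "\<And>i. cube_matching m (p i)"
  shows "cube_matching (2 * m) (vertical m p s)"
  unfolding cube_matching_def
proof (intro allI impI)
  fix z :: "bool list" assume "length z = 2 * m"
  then obtain x y where z: "z = x @ y" "length x = m" "length y = m" by (rule append_split)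
  define q where "q = (if parity x then p s else p (Suc s))"
  have q: "vertical m p s (x @ y') = x @ q y'" for y'
    using vertical_append[OF z(2)] by (simp add: q_def)
  have "cube_matching m q" using assms by (simp add: q_def)
  then obtain k where "k < m" "q y = y[k := \<not> y ! k]" and qq: "q (q y) = y"
    using z(3) unfolding cube_matching_def by blast
  then have "m + k < 2 * m" "vertical m p s z = z[m + k := \<not> z ! (m + k)]"
    using q z by (simp_all add: list_update_append nth_append)
  then show "vertical m p s (vertical m p s z) = z \<and>
      (\<exists>k<2 * m. vertical m p s z = z[k := \<not> z ! k])"
    using q z(1) qq by metis
qed

lemma finite_hypercube_verts: "finite (hypercube_verts m)"
  using finite_lists_length_eq[of "UNIV :: bool set" m] by (simp add: hypercube_verts_def)

lemma card_hypercube_verts: "card (hypercube_verts m) = 2 ^ m"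
  using card_lists_length_eq[of "UNIV :: bool set" m] by (simp add: hypercube_verts_def)

text \<open>The indices \<open>s\<close> and \<open>t\<close> are independent, so this covers a
  horizontal matching together with the vertical one before it as well as the one after it.\<close>

lemma linked_horizontal_vertical:
  assumes p: "\<And>i. cube_matching m (p i)"
    and l: "\<And>i. linked (hypercube_verts m) (p i) (p (Suc i))"
  shows "linked (hypercube_verts (2 * m)) (horizontal m p s) (vertical m p t)"
  unfolding linked_def
proof (intro allI impI)
  let ?V = "hypercube_verts m" and ?h = "horizontal m p s" and ?v = "vertical m p t"
  fix S assume S: "S \<subseteq> hypercube_verts (2 * m)" "S \<noteq> {}" "?h ` S \<subseteq> S" "?v ` S \<subseteq> S"
  obtain z0 where "z0 \<in> S" using S(2) by blast
  then have "length z0 = 2 * m" using S(1) by (auto simp: hypercube_verts_def)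
  then obtain x0 y0 where z0: "x0 @ y0 \<in> S" "length x0 = m" "length y0 = m"
    using \<open>z0 \<in> S\<close> by (metis append_split)
  \<comment> \<open>For an involution, closure of \<open>S\<close> yields the equivalence required
    of \<open>Q\<close>.\<close>
  have inv: "q z \<in> S \<longleftrightarrow> z \<in> S"
    if "cube_matching (2 * m) q" "q ` S \<subseteq> S" "length z = 2 * m" for q z
    using that unfolding cube_matching_def by (metis image_subset_iff)
  \<comment> \<open>The exceptional row is the zero word, which is even; the vertex
    \<open>x0 @ y0\<close> of \<open>S\<close> supplies the starting point at which \<open>Q\<close>
    holds.\<close>
  have "x @ y \<in> S" if xy: "x \<in> ?V" "y \<in> ?V" for x y
  proof (rule torus_connected[where V = ?V and col = parity and Q = "\<lambda>x y. x @ y \<in> S"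
        and ?x0.0 = x0 and ?y1.0 = y0 and ?y0.0 = "replicate m False"])
    show "(if y \<noteq> replicate m False \<and> parity y = parity (replicate m False)
        then p s x else p (Suc s) x) @ y \<in> S \<longleftrightarrow> x @ y \<in> S" if "x \<in> ?V" "y \<in> ?V" for x y
      using inv[OF cube_matching_horizontal[OF p] S(3), of "x @ y"] that
      by (simp add: horizontal_append hypercube_verts_def parity_replicate_False)
    show "x @ (if parity x then p t y else p (Suc t) y) \<in> S \<longleftrightarrow> x @ y \<in> S"
      if "x \<in> ?V" "y \<in> ?V" for x y
      using inv[OF cube_matching_vertical[OF p] S(4), of "x @ y"] that
      by (simp add: vertical_append hypercube_verts_def)
  qed (use z0 xy l finite_hypercube_verts cube_matching_flips[OF p] in
      \<open>auto simp: hypercube_verts_def\<close>)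
  then have "hypercube_verts (2 * m) \<subseteq> S"
    by (auto simp: hypercube_verts_def elim: append_split)
  then show "S = hypercube_verts (2 * m)" using S(1) by blast
qed

lemma matching_cycle_doubled:
  assumes "matching_cycle m p"
  shows "matching_cycle (2 * m) (doubled m p)"
proof -
  have p: "cube_matching m (p i)" and per: "p (i + m) = p i"
    and dist: "\<lbrakk>i < j; j < i + m; length v = m\<rbrakk> \<Longrightarrow> p i v \<noteq> p j v"
    and l: "linked (hypercube_verts m) (p i) (p (Suc i))" for i j v
    using assms by (auto simp: matching_cycle_def)
  have ne: "p i v \<noteq> v" if "length v = m" for i v
    using flipsD(3)[OF cube_matching_flips[OF p[of i]], of v] that
    by (auto simp: hypercube_verts_def)
  have "cube_matching (2 * m) (doubled m p i)" for i
    using cube_matching_horizontal[OF p] cube_matching_vertical[OF p] by (simp add: doubled_def)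
  moreover have "doubled m p (i + 2 * m) = doubled m p i" for i
    using per[of "i div 2"] per[of "Suc (i div 2)"]
    by (auto simp: doubled_def horizontal_def vertical_def fun_eq_iff add.commute)
  moreover have "doubled m p i z \<noteq> doubled m p j z"
    if ij: "i < j" "j < i + 2 * m" and len_z: "length z = 2 * m" for i j z
  proof -
    obtain x y where z: "z = x @ y" "length x = m" "length y = m"
      using len_z by (rule append_split)
    have len: "length (p k x) = m" for k using cube_matching_length[OF p z(2)] .
    show ?thesis
    proof (cases "even i \<longleftrightarrow> even j")
      case True
      \<comment> \<open>Matchings of the same direction choose the same branch at \<open>z\<close>,
        so their indices into \<open>p\<close> differ by \<open>j div 2 - i div 2\<close>, which is
        positive and less than \<open>m\<close>.\<close>
      then have "i div 2 < j div 2" "j div 2 < i div 2 + m" using ij by presburger+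
      then show ?thesis
        using True dist[of "i div 2" "j div 2"] dist[of "Suc (i div 2)" "Suc (j div 2)"] z len
        by (simp add: doubled_def horizontal_append vertical_append)
    next
      case False
      \<comment> \<open>A horizontal matching changes the first half of \<open>z\<close> and a
        vertical one the second half.\<close>
      then show ?thesis
        using z len ne[OF z(2)] ne[OF z(3)]
        by (auto simp: doubled_def horizontal_append vertical_append split: if_splits)
    qed
  qed
  moreover have "linked (hypercube_verts (2 * m)) (doubled m p i) (doubled m p (Suc i))" for i
    using linked_horizontal_vertical[of m p, OF p l]
    by (auto simp: doubled_def intro: linked_sym[THEN iffD1])
  ultimately show ?thesis by (simp add: matching_cycle_def)
qed

lemma matching_cycle_exists: "\<exists>p. matching_cycle (2 ^ n) p"
proof (induction n)
  case 0
  then show ?case using matching_cycle_1 by auto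
next
  case (Suc n)
  then show ?case using matching_cycle_doubled by auto
qed

section \<open>From involutions to edge sets\<close>

lemma cube_matching_edge:
  assumes "cube_matching m p" "v \<in> hypercube_verts m"
  shows "{v, p v} \<in> hypercube_edges m"
proof -
  obtain k where k: "k < m" "p v = v[k := \<not> v ! k]" and v: "length v = m"
    using assms unfolding cube_matching_def hypercube_verts_def by blast
  then have "{l. l < m \<and> v ! l \<noteq> p v ! l} = {k}"
    by (auto simp: nth_list_update)
  moreover have "p v \<in> hypercube_verts m"
    using cube_matching_length[OF assms(1) v] by (simp add: hypercube_verts_def)
  ultimately show ?thesis
    using assms(2) unfolding hypercube_edges_def by force
qed

text \<open>An edge \<open>{w, p w}\<close> through \<open>v\<close> has \<open>v = w\<close> or
  \<open>v = p w\<close>, and in the second case \<open>w = p v\<close>; either way it is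
  \<open>{v, p v}\<close>.\<close>

lemma perfect_matching_flips:
  assumes "flips V col p" "\<And>v. v \<in> V \<Longrightarrow> {v, p v} \<in> E"
  shows "perfect_matching V E ((\<lambda>v. {v, p v}) ` V)"
  unfolding perfect_matching_def
proof (intro conjI ballI)
  fix v assume v: "v \<in> V"
  show "\<exists>!e. e \<in> (\<lambda>v. {v, p v}) ` V \<and> v \<in> e"
  proof (rule ex1I[of _ "{v, p v}"])
    show "e = {v, p v}" if "e \<in> (\<lambda>v. {v, p v}) ` V \<and> v \<in> e" for e
      using that flipsD(2)[OF assms(1)] by auto
  qed (use v in auto)
qed (use assms in auto)

theorem theorem3p2:
  fixes n m :: nat
  assumes "n \<ge> 1" and "m = 2 ^ n"
  shows "\<exists>M :: nat \<Rightarrow> bool list set set.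
    (\<forall>i\<in>{1..m}. perfect_matching (hypercube_verts m) (hypercube_edges m) (M i)) \<and>
    (\<forall>i\<in>{1..m}. \<forall>j\<in>{1..m}. i \<noteq> j \<longrightarrow> M i \<inter> M j = {}) \<and>
    (\<forall>i\<in>{1..m}. hamiltonian_cycle_edges (hypercube_verts m) (hypercube_edges m)
                   (M i \<union> M (i mod m + 1)))"
proof -
  let ?V = "hypercube_verts m" and ?E = "hypercube_edges m"
  obtain p where "matching_cycle m p"
    using matching_cycle_exists assms(2) by blast
  then have p: "cube_matching m (p i)" and per: "p (i + m) = p i"
    and dist: "\<lbrakk>i < j; j < i + m; length v = m\<rbrakk> \<Longrightarrow> p i v \<noteq> p j v"
    and l: "linked ?V (p i) (p (Suc i))" for i j v
    by (auto simp: matching_cycle_def)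
  note fl = cube_matching_flips[OF p]
  define M where "M = (\<lambda>i. (\<lambda>v. {v, p i v}) ` ?V)"
  have M: "M i \<subseteq> ?E" "perfect_matching ?V ?E (M i)" for i
    using cube_matching_edge[OF p] perfect_matching_flips[OF fl] by (auto simp: M_def)
  have less: "M i \<inter> M j = {}" if "i < j" "j < i + m" for i j
  proof (rule ccontr)
    assume "M i \<inter> M j \<noteq> {}"
    then obtain v w where vw: "v \<in> ?V" "w \<in> ?V" "{v, p i v} = {w, p j w}"
      by (auto simp: M_def)
    then have "p i v = p j v"
      using flipsD(2)[OF fl[of j] vw(2)] by (auto simp: doubleton_eq_iff)
    then show False using dist[OF that, of v] vw(1) by (simp add: hypercube_verts_def)
  qed
  have "M i \<inter> M j = {}" if "i \<in> {1..m}" "j \<in> {1..m}" "i \<noteq> j" for i j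
  proof (cases "i < j")
    case True
    then show ?thesis using less[of i j] that by simp
  next
    case False
    then show ?thesis using less[of j i] that by (simp add: Int_commute)
  qed
  moreover have "hamiltonian_cycle_edges ?V ?E (M i \<union> M (i mod m + 1))" if "i \<in> {1..m}" for i
  proof -
    \<comment> \<open>Only \<open>i = m\<close> wraps around, where periodicity identifies
      \<open>M (Suc m)\<close> with \<open>M 1\<close>.\<close>
    have "M (i mod m + 1) = M (Suc i)"
      using that per[of 1] by (cases "i = m") (simp_all add: M_def)
    moreover have "?V \<noteq> {}" using card_hypercube_verts[of m] by auto
    then obtain vs where vs: "distinct vs" "set vs = ?V" "cyclic_edges vs = M i \<union> M (Suc i)"
      using linked_cycle[OF finite_hypercube_verts fl fl l] unfolding M_def by metis
    moreover have "3 \<le> length vs"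
    proof -
      \<comment> \<open>From \<open>n \<ge> 1\<close> follows \<open>m \<ge> 2\<close>, so there are
        at least four vertices.\<close>
      have "(2::nat) ^ 1 \<le> 2 ^ n" by (rule power_increasing) (use assms(1) in auto)
      then have "(2::nat) ^ 2 \<le> 2 ^ m" by (intro power_increasing) (use assms(2) in auto)
      then show ?thesis using vs(1,2) card_hypercube_verts[of m] distinct_card[of vs] by simp
    qed
    ultimately show ?thesis using M(1) unfolding hamiltonian_cycle_edges_def by (metis Un_least)
  qed
  ultimately show ?thesis using M(2) by blast
qed

end
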